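(* Let $A$ and $B$ be $S$-sorted sets whose components $A_s$ and $B_s$ are all finite. Let $\mathcal{M}_1 := \operatorname{mPol} Q_A$ and $\mathcal{M}_2 := \operatorname{mPol} Q_B$ for $Q_A \subseteq \operatorname{Relp}(A)$ and $Q_B \subseteq \operatorname{Relp}(B)$. Then the following conditions (I) and (II) are equivalent. (I) $\mathcal{M}_2 \in \mathsf{P}_{\mathrm{fin}}\,\mathcal{M}_1$, i.e., there is an integer $k\ge1$ with $B=A^k$ and $\mathcal M_2=\mathcal M_1^{\otimes k}$. (II) There exists an integer $k \ge 1$ such that $B = A^k$ and $\sharp_k[Q_A] = [Q_B]$. Moreover, these conditions imply the following: (III) There exists an integer $k \ge 1$ such that $B = A^k$ and $[\flat_k Q_B] = [Q_A]$.
   Context: $S$ is a set of sorts. An $S$-sorted set is a family $A=(A_s)_{s\in S}$ of sets; $A^k=(A_s^k)_{s\in S}$. $W(S)$ is the set of finite words over $S$ including the empty word $\varepsilon$; for $w=s_1\dots s_n$, $A_w:=A_{s_1}\times\dots\times A_{s_n}$, $A_\varepsilon=\{\emptyset\}$. An $S$-sorted operation on $A$ of declaration $(w,s)\in W(S)\times S$ is a function $f\colon A_w\to A_s$ (each operation carries its declaration); $\operatorname{Op}(A)$ is the set of all of them. For $f\in\operatorname{Op}(A)$, $f^{\otimes k}\in\operatorname{Op}(A^k)$ is the operation of the same declaration given by componentwise application of $f$, and $F^{\otimes k}:=\{f^{\otimes k}:f\in F\}$. An $m$-ary ($m\ge 0$) $S$-sorted relation on $A$ is a family $R=(R_s)_{s\in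 S}$ with $R_s\subseteq A_s^m$ (for $m=0$ each $R_s$ is $\emptyset$ or $\{\emptyset\}$); an $m$-ary relation pair is a pair $(R,R')$ of $m$-ary $S$-sorted relations, and $\operatorname{Relp}(A)$ is the set of relation pairs on $A$ of all arities. An operation $f\colon A_w\to A_s$, $w=s_1\dots s_n$, preserves $(R,R')$ if for all $m$-tuples $r_i\in R_{s_i}$ ($i=1,\dots,n$) the $m$-tuple obtained by applying $f$ coordinatewise to $r_1,\dots,r_n$ is in $R'_s$. $\operatorname{mPol}Q$ is the set of $f\in\operatorname{Op}(A)$ preserving all pairs in $Q$; $\operatorname{mInv}F$ is the set of relation pairs preserved by all $f\in F$. For $A$ with finite components, $[Q]:=\operatorname{mInv}\operatorname{mPol}Q$ (the minor-closure of $Q$). Lifting and flattening ($k\ge1$): $\sharp_k$ identifies a tuple of length $nk$ with entries in $A_s$ with the $n$-tuple over $A_s^k$ formed by its consecutive blocks of length $k$; $\flat_k$ is the inverse. They are applied elementwise and sortwise to relations and relation pairs. For $Q\subseteq\operatorname{Relp}(A)$, $\sharp_kQ:=\{\sharp_k(R,R'):(R,R')\in Q$ of arity divisible by $k\}\subseteq\operatorname{Relp}(A^k)$; for $T\subseteq\operatorname{Relp}(A^k)$, $\flat_kT:=\{\flat_k(R,R'):(R,R')\in T\}\subseteq\operatorname{Relp}(A)$. *)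

theory Defs
  imports "HOL-Library.FuncSet" "HOL-Library.NList"
begin

(* An S-sorted set is a function A on sorts of which only the values at s in S matter; tuples are
   lists, so that nlists k (A s) is the k-th power of the component A s, and
   listset (map A w) is the product of the components along the word w (it is {[]} if w = []). *)

definition sorted_power :: "nat \<Rightarrow> ('s \<Rightarrow> 'a set) \<Rightarrow> 's \<Rightarrow> 'a list set" where
  "sorted_power k A s = nlists k (A s)"

definition sorted_eq :: "'s set \<Rightarrow> ('s \<Rightarrow> 'a set) \<Rightarrow> ('s \<Rightarrow> 'a set) \<Rightarrow> bool" where
  "sorted_eq S A B \<longleftrightarrow> (\<forall>s\<in>S. A s = B s)"

definition word_prod :: "('s \<Rightarrow> 'a set) \<Rightarrow> 's list \<Rightarrow> 'a list set" where
  "word_prod A w = listset (map A w)"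

(* An operation is stored with its declaration (w, s), a relation pair with its arity m. Without
   the arity, pairs of empty relations of different arities would be identified. *)

type_synonym ('s, 'a) sorted_op = "'s list \<times> 's \<times> ('a list \<Rightarrow> 'a)"

type_synonym ('s, 'a) sorted_rel = "'s \<Rightarrow> 'a list set"

type_synonym ('s, 'a) rel_pair = "nat \<times> ('s, 'a) sorted_rel \<times> ('s, 'a) sorted_rel"

definition Op :: "'s set \<Rightarrow> ('s \<Rightarrow> 'a set) \<Rightarrow> ('s, 'a) sorted_op set" where
  "Op S A = {(w, s, f). w \<in> lists S \<and> s \<in> S \<and> f \<in> word_prod A w \<rightarrow>\<^sub>E A s}"

definition Rel :: "'s set \<Rightarrow> ('s \<Rightarrow> 'a set) \<Rightarrow> nat \<Rightarrow> ('s, 'a) sorted_rel set" where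
  "Rel S A m = (\<Pi>\<^sub>E s\<in>S. Pow (nlists m (A s)))"

definition Relp :: "'s set \<Rightarrow> ('s \<Rightarrow> 'a set) \<Rightarrow> ('s, 'a) rel_pair set" where
  "Relp S A = {(m, R, R'). R \<in> Rel S A m \<and> R' \<in> Rel S A m}"

(* rs is a list of m-tuples, the "rows"; f is applied to each of the m "columns". *)
definition coordinatewise :: "nat \<Rightarrow> ('a list \<Rightarrow> 'a) \<Rightarrow> 'a list list \<Rightarrow> 'a list" where
  "coordinatewise m f rs = map (\<lambda>j. f (map (\<lambda>r. r ! j) rs)) [0..<m]"

fun op_power :: "('s \<Rightarrow> 'a set) \<Rightarrow> nat \<Rightarrow> ('s, 'a) sorted_op \<Rightarrow> ('s, 'a list) sorted_op" where
  "op_power A k (w, s, f) = (w, s, restrict (coordinatewise k f) (word_prod (sorted_power k A) w))"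

fun preserves :: "('s, 'a) sorted_op \<Rightarrow> ('s, 'a) rel_pair \<Rightarrow> bool" where
  "preserves (w, s, f) (m, R, R') \<longleftrightarrow> (\<forall>rs \<in> word_prod R w. coordinatewise m f rs \<in> R' s)"

definition mPol :: "'s set \<Rightarrow> ('s \<Rightarrow> 'a set) \<Rightarrow> ('s, 'a) rel_pair set \<Rightarrow> ('s, 'a) sorted_op set" where
  "mPol S A Q = {f \<in> Op S A. \<forall>q\<in>Q. preserves f q}"

definition mInv :: "'s set \<Rightarrow> ('s \<Rightarrow> 'a set) \<Rightarrow> ('s, 'a) sorted_op set \<Rightarrow> ('s, 'a) rel_pair set" where
  "mInv S A F = {q \<in> Relp S A. \<forall>f\<in>F. preserves f q}"

definition minor_closure ::
    "'s set \<Rightarrow> ('s \<Rightarrow> 'a set) \<Rightarrow> ('s, 'a) rel_pair set \<Rightarrow> ('s, 'a) rel_pair set" where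
  "minor_closure S A Q = mInv S A (mPol S A Q)"

definition sharp_tuple :: "nat \<Rightarrow> 'a list \<Rightarrow> 'a list list" where
  "sharp_tuple k x = map (\<lambda>i. take k (drop (i * k) x)) [0..<length x div k]"

definition flat_tuple :: "'a list list \<Rightarrow> 'a list" where
  "flat_tuple y = concat y"

definition sharp :: "'s set \<Rightarrow> nat \<Rightarrow> ('s, 'a) rel_pair set \<Rightarrow> ('s, 'a list) rel_pair set" where
  "sharp S k Q = {(n, (\<lambda>s\<in>S. sharp_tuple k ` R s), (\<lambda>s\<in>S. sharp_tuple k ` R' s)) | n R R'.
     (n * k, R, R') \<in> Q}"

definition flat :: "'s set \<Rightarrow> nat \<Rightarrow> ('s, 'a list) rel_pair set \<Rightarrow> ('s, 'a) rel_pair set" where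
  "flat S k T = {(n * k, (\<lambda>s\<in>S. flat_tuple ` R s), (\<lambda>s\<in>S. flat_tuple ` R' s)) | n R R'.
     (n, R, R') \<in> T}"

lemma flat_sharp_tuple:
  assumes "x \<in> nlists (n * k) A"
  shows "flat_tuple (sharp_tuple k x) = x"
proof -
  have "concat (map (\<lambda>i. take k (drop (i * k) x)) [0..<j]) = take (j * k) x" for j
  proof (induction j)
    case (Suc j)
    then show ?case
      by (simp only: upt_Suc_append[OF zero_le] map_append concat_append list.map concat.simps
          append_Nil2 mult_Suc add.commute[of k] take_add)
  qed simp
  moreover have "length x div k * k = length x"
    unfolding nlistsE_length[OF assms] by simp
  ultimately show ?thesis
    by (simp only: flat_tuple_def sharp_tuple_def take_all order.refl)
qed

lemma sharp_flat_tuple: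
  assumes "k \<ge> 1" "y \<in> nlists n (nlists k A)"
  shows "sharp_tuple k (flat_tuple y) = y"
  using assms(2)
proof (induction y arbitrary: n)
  case Nil
  show ?case
    by (simp only: flat_tuple_def sharp_tuple_def concat.simps list.size div_0 upt_0 list.map)
next
  case (Cons a y)
  from Cons.prems have a: "length a = k" and y: "y \<in> nlists (length y) (nlists k A)"
    by (simp_all only: nlists_def mem_Collect_eq) auto
  let ?c = "concat y"
  have "length (a @ ?c) div k = Suc (length ?c div k)"
    using a assms(1) div_add_self1[of k "length ?c"] by simp
  moreover have "[0..<Suc (length ?c div k)] = 0 # map Suc [0..<length ?c div k]"
    unfolding map_Suc_upt by (rule upt_conv_Cons) (rule zero_less_Suc)
  ultimately have "sharp_tuple k (a @ ?c) =
      take k (a @ ?c) # map (\<lambda>i. take k (drop (Suc i * k) (a @ ?c))) [0..<length ?c div k]"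
    by (simp only: sharp_tuple_def list.map map_map o_def mult_0 drop_0)
  also have "\<dots> = a # sharp_tuple k ?c"
    using a unfolding sharp_tuple_def by simp
  also have "sharp_tuple k ?c = y"
    using Cons.IH[OF y] by (simp only: flat_tuple_def)
  finally show ?case
    by (simp only: flat_tuple_def concat.simps)
qed

end

theory Submission
  imports Defs
begin

text \<open>
  Everything comes from the Galois connection between operations and relation pairs, once
  liftings are understood on the relational side. Three facts carry the argument.

  First, \<open>f\<^sup>\<otimes>\<^sup>k\<close> applies \<open>f\<close> in every coordinate of every block, and this is
  what \<open>f\<close> itself does to the concatenation of the blocks. So \<open>f\<^sup>\<otimes>\<^sup>k\<close> preserves a
  relation pair over \<open>A\<^sup>k\<close> iff \<open>f\<close> preserves the flattened pair
  (\<open>preserves_op_power_iff\<close>). Since every pair over \<open>A\<^sup>k\<close> is the lifting of its flattening, it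
  follows that lifting the invariants of \<open>M\<close> yields exactly the invariants of \<open>M\<^sup>\<otimes>\<^sup>k\<close>
  (\<open>sharp_mInv\<close>).

  Secondly, over finite components a set of operations is determined by its invariant relation
  pairs as soon as it is closed under minors, that is, under permuting, identifying and adding
  arguments (\<open>mPol_mInv_minor_closed\<close>). For an operation \<open>g\<close> of declaration \<open>(w, s)\<close> one tests
  the pair whose first relation consists of the rows of the matrix of all argument tuples of \<open>g\<close>,
  and whose second relation consists of everything that the given operations produce from these
  rows. If \<open>g\<close> preserves it, then the value table of \<open>g\<close> is produced by one of those operations, and
  this makes \<open>g\<close> a minor of it.

  Thirdly, sets of the form \<open>mPol Q\<close> and their powers are closed under minors.

  Consequently \<open>M\<^sub>2 = M\<^sub>1\<^sup>\<otimes>\<^sup>k\<close> holds iff the two sides have the same invariants, and those are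
  \<open>[Q\<^sub>B]\<close> and \<open>\<sharp>\<^sub>k[Q\<^sub>A]\<close>. For the last implication, \<open>f\<close> preserves \<open>\<flat>\<^sub>k Q\<^sub>B\<close> iff
  \<open>f\<^sup>\<otimes>\<^sup>k \<in> M\<^sub>2 = M\<^sub>1\<^sup>\<otimes>\<^sup>k\<close>, which for \<open>k \<ge> 1\<close> means \<open>f \<in> M\<^sub>1\<close>, because then the power operation is
  injective. Hence \<open>\<flat>\<^sub>k Q\<^sub>B\<close> and \<open>Q\<^sub>A\<close> have the same polymorphisms.
\<close>

section \<open>Tuples along a word\<close>

text \<open>As rewrite rules, these two make the simplifier search for a membership in some \<open>nlists n A\<close>
  at every length or set of a list; together with \<open>nlists_iff_nth\<close> below that search does not end.\<close>

declare nlistsE_length [simp del] nlistsE_set [simp del]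

lemma word_prod_iff:
  "x \<in> word_prod A w \<longleftrightarrow> length x = length w \<and> (\<forall>i<length w. x ! i \<in> A (w ! i))"
proof (induction w arbitrary: x)
  case Nil
  then show ?case by (simp add: word_prod_def)
next
  case (Cons s w)
  then show ?case
    by (cases x) (auto simp: word_prod_def set_Cons_def nth_Cons All_less_Suc2 split: nat.split)
qed

lemma nlists_iff_nth: "x \<in> nlists n A \<longleftrightarrow> length x = n \<and> (\<forall>i<n. x ! i \<in> A)"
  by (auto simp: nlists_def in_set_conv_nth subset_iff)

lemma word_prod_cong:
  assumes "w \<in> lists S" "\<And>s. s \<in> S \<Longrightarrow> A s = B s"
  shows "word_prod A w = word_prod B w"
  using assms by (auto simp: word_prod_iff in_lists_conv_set)

lemma finite_word_prod:
  assumes "w \<in> lists S" "\<forall>s\<in>S. finite (A s)"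
  shows "finite (word_prod A w)"
proof -
  have "word_prod A w \<subseteq> {x. set x \<subseteq> (\<Union>s\<in>set w. A s) \<and> length x = length w}"
    by (force simp: word_prod_iff in_set_conv_nth)
  moreover have "finite \<dots>"
    using assms by (intro finite_lists_length_eq) auto
  ultimately show ?thesis by (rule finite_subset)
qed

lemma word_prod_image: "word_prod (\<lambda>s. f ` R s) w = map f ` word_prod R w"
proof -
  have "\<exists>y\<in>word_prod R w. x = map f y" if x: "x \<in> word_prod (\<lambda>s. f ` R s) w" for x
  proof -
    from x have "\<forall>i<length w. \<exists>r. r \<in> R (w ! i) \<and> x ! i = f r"
      by (auto simp: word_prod_iff)
    then obtain r where "\<And>i. i < length w \<Longrightarrow> r i \<in> R (w ! i) \<and> x ! i = f (r i)"
      by metis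
    with x show ?thesis
      by (intro bexI[of _ "map r [0..<length w]"]) (auto simp: word_prod_iff intro!: nth_equalityI)
  qed
  then have "word_prod (\<lambda>s. f ` R s) w \<subseteq> map f ` word_prod R w" by blast
  then show ?thesis by (auto simp: word_prod_iff)
qed

lemma RelD: "R \<in> Rel S A m \<Longrightarrow> s \<in> S \<Longrightarrow> R s \<subseteq> nlists m (A s)"
  by (auto simp: Rel_def PiE_iff)

lemma column_in_word_prod:
  assumes "rs \<in> word_prod R w" "w \<in> lists S" "\<forall>s\<in>S. R s \<subseteq> nlists m (A s)" "j < m"
  shows "map (\<lambda>r. r ! j) rs \<in> word_prod A w"
  unfolding word_prod_iff
proof (intro conjI allI impI)
  show "length (map (\<lambda>r. r ! j) rs) = length w"
    using assms(1) by (simp add: word_prod_iff)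
next
  fix i assume i: "i < length w"
  with assms(2) have "w ! i \<in> S" by (auto simp: in_lists_conv_set)
  from bspec[OF assms(3) this] have "rs ! i \<in> nlists m (A (w ! i))"
    using assms(1) i by (auto simp: word_prod_iff)
  with assms(1,4) i show "map (\<lambda>r. r ! j) rs ! i \<in> A (w ! i)"
    by (simp add: word_prod_iff nlists_iff_nth)
qed

lemma coordinatewise_in_nlists:
  assumes "(w, s, f) \<in> Op S A" "rs \<in> word_prod R w" "\<forall>s\<in>S. R s \<subseteq> nlists m (A s)"
  shows "coordinatewise m f rs \<in> nlists m (A s)"
proof -
  from assms(1) have w: "w \<in> lists S" and f: "f \<in> word_prod A w \<rightarrow> A s"
    by (auto simp: Op_def)
  show ?thesis
    using funcset_mem[OF f column_in_word_prod[OF assms(2) w assms(3)]]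
    by (auto simp: nlists_iff_nth coordinatewise_def)
qed

section \<open>Powers of operations and flattening\<close>

lemma op_power_in_Op:
  assumes "f \<in> Op S A"
  shows "op_power A k f \<in> Op S (sorted_power k A)"
proof (cases f)
  case (fields w s g)
  with assms have "(w, s, g) \<in> Op S A" by simp
  then show ?thesis
    using coordinatewise_in_nlists[of w s g S A _ "sorted_power k A" k]
    by (auto simp: fields Op_def sorted_power_def)
qed

text \<open>The values of \<open>f\<close> can be read off from the values of \<open>f\<^sup>\<otimes>\<^sup>k\<close> at tuples of constant
  \<open>k\<close>-tuples; this requires that there is at least one coordinate.\<close>

lemma inj_on_op_power:
  assumes "k \<ge> 1"
  shows "inj_on (op_power A k) (Op S A)"
proof (rule inj_onI)
  fix f g assume f: "f \<in> Op S A" and g: "g \<in> Op S A" and eq: "op_power A k f = op_power A k g"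
  obtain w s f' where f': "f = (w, s, f')" by (cases f)
  with eq obtain g' where g': "g = (w, s, g')" by (cases g) auto
  have "f' x = g' x" if x: "x \<in> word_prod A w" for x
  proof -
    let ?c = "map (replicate k) x"
    have "?c \<in> word_prod (sorted_power k A) w"
      using x by (auto simp: word_prod_iff sorted_power_def nlists_iff_nth)
    moreover have "restrict (coordinatewise k f') (word_prod (sorted_power k A) w) =
        restrict (coordinatewise k g') (word_prod (sorted_power k A) w)"
      using eq by (simp add: f' g')
    ultimately have "coordinatewise k f' ?c ! 0 = coordinatewise k g' ?c ! 0"
      by (metis restrict_apply')
    moreover have "map (\<lambda>r. r ! 0) ?c = x"
      using assms by (auto intro!: nth_equalityI)
    ultimately show ?thesis
      using assms by (simp add: coordinatewise_def comp_def)
  qed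
  with f g show "f = g"
    by (auto simp: f' g' Op_def intro: PiE_ext)
qed

definition flat_pair :: "'s set \<Rightarrow> nat \<Rightarrow> ('s, 'a list) rel_pair \<Rightarrow> ('s, 'a) rel_pair" where
  "flat_pair S k = (\<lambda>(n, R, R').
     (n * k, (\<lambda>s\<in>S. flat_tuple ` R s), (\<lambda>s\<in>S. flat_tuple ` R' s)))"

lemma flat_eq_image: "flat S k T = flat_pair S k ` T"
  by (force simp: flat_def flat_pair_def image_def)

lemma nth_concat_blocks:
  assumes "y \<in> nlists n (nlists k A)" "i < n" "j < k"
  shows "concat y ! (i * k + j) = y ! i ! j"
  using assms
proof (induction y arbitrary: n i)
  case Nil
  then show ?case by (auto simp: nlists_def)
next
  case (Cons a y)
  then obtain m where n: "n = Suc m" and y: "y \<in> nlists m (nlists k A)" and a: "length a = k"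
    by (cases n) (auto simp: nlistsE_length)
  show ?case
  proof (cases i)
    case 0
    with a Cons.prems show ?thesis by (simp add: nth_append)
  next
    case (Suc i')
    with Cons.IH[OF y, of i'] Cons.prems n a show ?thesis by (simp add: nth_append)
  qed
qed

lemma flat_tuple_in_nlists:
  assumes "y \<in> nlists n (nlists k A)"
  shows "flat_tuple y \<in> nlists (n * k) A"
  using assms
proof (induction y arbitrary: n)
  case Nil
  then show ?case by (auto simp: flat_tuple_def nlists_def)
next
  case (Cons a y)
  then obtain m where n: "n = Suc m" and y: "y \<in> nlists m (nlists k A)" and a: "a \<in> nlists k A"
    by (cases n) auto
  from Cons.IH[OF y] a show ?case by (auto simp: n flat_tuple_def nlists_def)
qed

lemma sharp_tuple_in_nlists:
  assumes "x \<in> nlists (n * k) A" "k \<ge> 1"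
  shows "sharp_tuple k x \<in> nlists n (nlists k A)"
proof -
  have "i * k + j < n * k" if "i < n" "j < k" for i j
  proof -
    from that have "i * k + j < Suc i * k" by simp
    also have "\<dots> \<le> n * k" using that by (intro mult_right_mono) auto
    finally show ?thesis .
  qed
  moreover have "i * k + k \<le> n * k" if "i < n" for i
    using mult_right_mono[of "Suc i" n k] that by simp
  ultimately show ?thesis
    using assms by (fastforce simp: nlists_iff_nth sharp_tuple_def)
qed

lemma map_upt_blocks:
  "map g [0..<n * k] = concat (map (\<lambda>i. map (\<lambda>j. g (i * k + j)) [0..<k]) [0..<n])"
proof (induction n)
  case 0
  then show ?case by simp
next
  case (Suc n)
  have "[0..<Suc n * k] = [0..<n * k] @ map (\<lambda>j. j + n * k) [0..<k]"
    using upt_add_eq_append[of 0 "n * k" k] by (simp add: map_add_upt add.commute)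
  with Suc.IH show ?case by (simp add: comp_def add.commute)
qed

text \<open>Column \<open>i * k + j\<close> of the concatenated rows is column \<open>j\<close> inside block column \<open>i\<close>.\<close>

lemma coordinatewise_flat:
  assumes rs: "rs \<in> word_prod R w" and w: "w \<in> lists S"
    and R: "\<forall>s\<in>S. R s \<subseteq> nlists n (sorted_power k A s)"
  shows "coordinatewise (n * k) f (map flat_tuple rs) =
    flat_tuple (coordinatewise n (coordinatewise k f) rs)"
proof -
  have "map (\<lambda>r. flat_tuple r ! (i * k + j)) rs = map (\<lambda>r. r ! i ! j) rs"
    if "i < n" "j < k" for i j
  proof (rule map_cong[OF refl])
    fix r assume "r \<in> set rs"
    with rs obtain l where l: "l < length w" "r \<in> R (w ! l)"
      by (auto simp: in_set_conv_nth word_prod_iff)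
    with w have "w ! l \<in> S" by (auto simp: in_lists_conv_set)
    with R l have "r \<in> nlists n (nlists k (A (w ! l)))"
      by (auto simp: sorted_power_def)
    from nth_concat_blocks[OF this that]
    show "flat_tuple r ! (i * k + j) = r ! i ! j" by (simp add: flat_tuple_def)
  qed
  then have column: "map (\<lambda>r. r ! (i * k + j)) (map flat_tuple rs) =
      map (\<lambda>r. r ! j) (map (\<lambda>r. r ! i) rs)" if "i < n" "j < k" for i j
    using that unfolding map_map comp_def by blast
  have "coordinatewise n (coordinatewise k f) rs = map (\<lambda>i. map (\<lambda>j.
      f (map (\<lambda>r. r ! (i * k + j)) (map flat_tuple rs))) [0..<k]) [0..<n]"
    unfolding coordinatewise_def
    by (intro map_cong refl arg_cong[of _ _ f] column[symmetric]) auto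
  then show ?thesis
    by (simp only: coordinatewise_def[of "n * k"] flat_tuple_def map_upt_blocks)
qed

lemma flat_tuple_image_iff:
  assumes "k \<ge> 1" "X \<subseteq> nlists n (nlists k A)" "y \<in> nlists n (nlists k A)"
  shows "flat_tuple y \<in> flat_tuple ` X \<longleftrightarrow> y \<in> X"
  using assms sharp_flat_tuple[OF assms(1)] by (metis (no_types, lifting) image_iff subsetD)

text \<open>By \<open>coordinatewise_flat\<close> the two preservation conditions speak of the same tuples; passing to
  concatenations loses nothing because tuples of \<open>k\<close>-tuples can be recovered from them.\<close>

lemma preserves_op_power_iff:
  assumes "k \<ge> 1" "f \<in> Op S A" "T \<in> Relp S (sorted_power k A)"
  shows "preserves (op_power A k f) T \<longleftrightarrow> preserves f (flat_pair S k T)"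
proof -
  obtain w s g where f: "f = (w, s, g)" by (cases f)
  obtain n R R' where T: "T = (n, R, R')" by (cases T)
  from assms(3) have R: "\<forall>t\<in>S. R t \<subseteq> nlists n (sorted_power k A t)"
    and R': "\<And>t. t \<in> S \<Longrightarrow> R' t \<subseteq> nlists n (nlists k (A t))"
    by (auto simp: T Relp_def sorted_power_def dest!: RelD)
  from assms(2) have w: "w \<in> lists S" and s: "s \<in> S"
    by (auto simp: f Op_def)
  let ?G = "restrict (coordinatewise k g) (word_prod (sorted_power k A) w)"
  have G: "coordinatewise n ?G rs = coordinatewise n (coordinatewise k g) rs"
    if "rs \<in> word_prod R w" for rs
    using column_in_word_prod[OF that w R] by (simp add: coordinatewise_def)
  have "coordinatewise n ?G rs \<in> R' s \<longleftrightarrow>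
      coordinatewise (n * k) g (map flat_tuple rs) \<in> flat_tuple ` R' s"
    if rs: "rs \<in> word_prod R w" for rs
  proof -
    have "(w, s, ?G) \<in> Op S (sorted_power k A)"
      using op_power_in_Op[OF assms(2), of k] by (simp add: f)
    from coordinatewise_in_nlists[OF this rs R]
    have "coordinatewise n ?G rs \<in> nlists n (nlists k (A s))"
      by (simp add: sorted_power_def)
    from flat_tuple_image_iff[OF assms(1) R'[OF s] this]
    show ?thesis
      unfolding coordinatewise_flat[OF rs w R] G[OF rs] by simp
  qed
  moreover have "word_prod (\<lambda>s\<in>S. flat_tuple ` R s) w = map flat_tuple ` word_prod R w"
    by (subst word_prod_cong[OF w, of _ "\<lambda>s. flat_tuple ` R s"]) (simp_all add: word_prod_image)
  ultimately show ?thesis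
    using s by (simp add: f T flat_pair_def)
qed

lemma Rel_image:
  assumes "X \<in> Rel S A m" "\<And>s x. s \<in> S \<Longrightarrow> x \<in> nlists m (A s) \<Longrightarrow> g x \<in> nlists n (B s)"
  shows "(\<lambda>s\<in>S. g ` X s) \<in> Rel S B n"
proof -
  have "g ` X s \<subseteq> nlists n (B s)" if "s \<in> S" for s
    using RelD[OF assms(1) that] assms(2)[OF that] by blast
  then show ?thesis by (simp add: Rel_def)
qed

lemma Rel_image_inverse:
  assumes "X \<in> Rel S A m" "\<And>s x. s \<in> S \<Longrightarrow> x \<in> nlists m (A s) \<Longrightarrow> h (g x) = x"
  shows "(\<lambda>s\<in>S. h ` (\<lambda>s\<in>S. g ` X s) s) = X"
proof (rule extensionalityI[of _ S])
  show "X \<in> extensional S" using assms(1) by (simp add: Rel_def PiE_def)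
  fix s assume s: "s \<in> S"
  have "h (g x) = x" if "x \<in> X s" for x
    using RelD[OF assms(1) s] assms(2)[OF s] that by blast
  with s show "(\<lambda>s\<in>S. h ` (\<lambda>s\<in>S. g ` X s) s) s = X s"
    by (simp add: image_image)
qed simp

lemma flat_pair_in_Relp:
  assumes "T \<in> Relp S (sorted_power k A)"
  shows "flat_pair S k T \<in> Relp S A"
proof -
  have "(\<lambda>s\<in>S. flat_tuple ` X s) \<in> Rel S A (n * k)" if "X \<in> Rel S (sorted_power k A) n" for X n
    by (rule Rel_image[OF that]) (simp add: sorted_power_def flat_tuple_in_nlists)
  with assms show ?thesis
    by (auto simp: Relp_def flat_pair_def)
qed

text \<open>Lifting and flattening are mutually inverse on relation pairs whose arity is a multiple of \<open>k\<close>,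
  and only such pairs contribute to \<open>sharp\<close>. Describing \<open>sharp\<close> as a preimage makes membership in
  it a condition on the flattened pair, where \<open>preserves_op_power_iff\<close> applies.\<close>

lemma sharp_eq_flat_vimage:
  assumes "k \<ge> 1" "Q \<subseteq> Relp S A"
  shows "sharp S k Q = {T \<in> Relp S (sorted_power k A). flat_pair S k T \<in> Q}"
proof (intro equalityI subsetI)
  fix T assume "T \<in> sharp S k Q"
  then obtain n R R' where T: "T = (n, (\<lambda>s\<in>S. sharp_tuple k ` R s), (\<lambda>s\<in>S. sharp_tuple k ` R' s))"
    and Q: "(n * k, R, R') \<in> Q"
    by (auto simp: sharp_def)
  have "(\<lambda>s\<in>S. sharp_tuple k ` X s) \<in> Rel S (sorted_power k A) n"
    and "(\<lambda>s\<in>S. flat_tuple ` (\<lambda>s\<in>S. sharp_tuple k ` X s) s) = X"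
    if "X \<in> Rel S A (n * k)" for X
    using Rel_image[OF that, of "sharp_tuple k" n "sorted_power k A"]
      Rel_image_inverse[OF that, of flat_tuple "sharp_tuple k"]
    by (simp_all add: sorted_power_def sharp_tuple_in_nlists[OF _ assms(1)] flat_sharp_tuple)
  moreover from Q assms(2) have "R \<in> Rel S A (n * k)" "R' \<in> Rel S A (n * k)"
    by (auto simp: Relp_def)
  ultimately show "T \<in> {T \<in> Relp S (sorted_power k A). flat_pair S k T \<in> Q}"
    using Q by (simp add: T Relp_def flat_pair_def)
next
  fix T assume T': "T \<in> {T \<in> Relp S (sorted_power k A). flat_pair S k T \<in> Q}"
  obtain n R R' where T: "T = (n, R, R')" by (cases T)
  have "(\<lambda>s\<in>S. sharp_tuple k ` (\<lambda>s\<in>S. flat_tuple ` X s) s) = X"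
    if "X \<in> Rel S (sorted_power k A) n" for X
    by (rule Rel_image_inverse[OF that])
      (simp add: sorted_power_def sharp_flat_tuple[OF assms(1)])
  moreover from T' have "R \<in> Rel S (sorted_power k A) n" "R' \<in> Rel S (sorted_power k A) n"
    by (auto simp: T Relp_def)
  ultimately have "T = (n, (\<lambda>s\<in>S. sharp_tuple k ` (\<lambda>s\<in>S. flat_tuple ` R s) s),
      (\<lambda>s\<in>S. sharp_tuple k ` (\<lambda>s\<in>S. flat_tuple ` R' s) s))"
    by (simp only: T)
  moreover from T' have "(n * k, (\<lambda>s\<in>S. flat_tuple ` R s), (\<lambda>s\<in>S. flat_tuple ` R' s)) \<in> Q"
    by (simp add: T flat_pair_def)
  ultimately show "T \<in> sharp S k Q"
    unfolding sharp_def by blast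
qed

lemma sharp_mInv:
  assumes "k \<ge> 1" "M \<subseteq> Op S A"
  shows "sharp S k (mInv S A M) = mInv S (sorted_power k A) (op_power A k ` M)"
proof -
  have "mInv S A M \<subseteq> Relp S A" by (auto simp: mInv_def)
  from sharp_eq_flat_vimage[OF assms(1) this]
  have "sharp S k (mInv S A M) =
      {T \<in> Relp S (sorted_power k A). flat_pair S k T \<in> mInv S A M}" .
  moreover have "flat_pair S k T \<in> mInv S A M \<longleftrightarrow> (\<forall>f\<in>M. preserves (op_power A k f) T)"
    if "T \<in> Relp S (sorted_power k A)" for T
    using flat_pair_in_Relp[OF that] preserves_op_power_iff[OF assms(1) subsetD[OF assms(2)] that]
    by (simp add: mInv_def)
  ultimately show ?thesis
    by (simp add: mInv_def[of S "sorted_power k A"] cong: conj_cong)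
qed

section \<open>Sets of operations closed under minors\<close>

text \<open>The list \<open>ps\<close> says which argument of the minor is put into each argument place of \<open>h\<close>.\<close>

definition minor_fun :: "('s \<Rightarrow> 'a set) \<Rightarrow> 's list \<Rightarrow> nat list \<Rightarrow> ('a list \<Rightarrow> 'a) \<Rightarrow> 'a list \<Rightarrow> 'a" where
  "minor_fun A w ps h = (\<lambda>x\<in>word_prod A w. h (map ((!) x) ps))"

definition minor_closed :: "'s set \<Rightarrow> ('s \<Rightarrow> 'a set) \<Rightarrow> ('s, 'a) sorted_op set \<Rightarrow> bool" where
  "minor_closed S A F \<longleftrightarrow> (\<forall>w ps s h. w \<in> lists S \<longrightarrow> set ps \<subseteq> {..<length w} \<longrightarrow>
     (map ((!) w) ps, s, h) \<in> F \<longrightarrow> (w, s, minor_fun A w ps h) \<in> F)"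

lemma select_in_word_prod:
  assumes "x \<in> word_prod A w" "set ps \<subseteq> {..<length w}"
  shows "map ((!) x) ps \<in> word_prod A (map ((!) w) ps)"
  using assms by (auto simp: word_prod_iff subset_iff)

text \<open>Selecting arguments permutes and repeats rows, which commutes with taking columns. The
  statement serves both preservation of relations and, with \<open>R\<close> a power of \<open>A\<close>, powers of minors.\<close>

lemma coordinatewise_minor_fun:
  assumes rs: "rs \<in> word_prod R w" and w: "w \<in> lists S" and ps: "set ps \<subseteq> {..<length w}"
    and R: "\<forall>s\<in>S. R s \<subseteq> nlists m (A s)"
  shows "coordinatewise m (minor_fun A w ps h) rs = coordinatewise m h (map ((!) rs) ps)"
proof -
  have "minor_fun A w ps h (map (\<lambda>r. r ! j) rs) = h (map (\<lambda>r. r ! j) (map ((!) rs) ps))"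
    if j: "j < m" for j
  proof -
    have "map ((!) (map (\<lambda>r. r ! j) rs)) ps = map (\<lambda>r. r ! j) (map ((!) rs) ps)"
      using rs ps by (auto simp: word_prod_iff subset_iff)
    with column_in_word_prod[OF rs w R j] show ?thesis
      by (simp only: minor_fun_def restrict_apply')
  qed
  then show ?thesis
    unfolding coordinatewise_def by (intro map_cong refl) (metis atLeastLessThan_iff set_upt)
qed

lemma minor_closed_mPol:
  assumes "Q \<subseteq> Relp S A"
  shows "minor_closed S A (mPol S A Q)"
  unfolding minor_closed_def
proof (intro allI impI)
  fix w ps s h
  assume w: "w \<in> lists S" and ps: "set ps \<subseteq> {..<length w}"
    and h: "(map ((!) w) ps, s, h) \<in> mPol S A Q"
  from h have "(w, s, minor_fun A w ps h) \<in> Op S A"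
    using funcset_mem[OF _ select_in_word_prod[OF _ ps]] w
    by (auto simp: mPol_def Op_def minor_fun_def PiE_def)
  moreover have "preserves (w, s, minor_fun A w ps h) (m, R, R')" if q: "(m, R, R') \<in> Q" for m R R'
  proof -
    from q assms have R: "\<forall>t\<in>S. R t \<subseteq> nlists m (A t)"
      by (auto simp: Relp_def dest!: RelD)
    have "preserves (map ((!) w) ps, s, h) (m, R, R')"
      using h q by (auto simp: mPol_def)
    then show ?thesis
      using coordinatewise_minor_fun[OF _ w ps R] select_in_word_prod[OF _ ps, of _ R] by simp
  qed
  ultimately show "(w, s, minor_fun A w ps h) \<in> mPol S A Q"
    by (auto simp: mPol_def)
qed

lemma minor_closed_op_power:
  assumes "minor_closed S A M"
  shows "minor_closed S (sorted_power k A) (op_power A k ` M)"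
  unfolding minor_closed_def
proof (intro allI impI)
  fix w ps s g
  assume w: "w \<in> lists S" and ps: "set ps \<subseteq> {..<length w}"
    and g: "(map ((!) w) ps, s, g) \<in> op_power A k ` M"
  then obtain h where h: "(map ((!) w) ps, s, h) \<in> M"
    and g_eq: "g = restrict (coordinatewise k h) (word_prod (sorted_power k A) (map ((!) w) ps))"
    by auto
  have "minor_fun (sorted_power k A) w ps g =
      restrict (coordinatewise k (minor_fun A w ps h)) (word_prod (sorted_power k A) w)"
    unfolding minor_fun_def[of "sorted_power k A"]
  proof (rule restrict_ext)
    fix x assume x: "x \<in> word_prod (sorted_power k A) w"
    have "g (map ((!) x) ps) = coordinatewise k h (map ((!) x) ps)"
      unfolding g_eq using select_in_word_prod[OF x ps] by (rule restrict_apply')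
    also have "\<dots> = coordinatewise k (minor_fun A w ps h) x"
      using x w ps by (intro coordinatewise_minor_fun[symmetric]) (auto simp: sorted_power_def)
    finally show "g (map ((!) x) ps) = coordinatewise k (minor_fun A w ps h) x" .
  qed
  then have "(w, s, minor_fun (sorted_power k A) w ps g) =
      op_power A k (w, s, minor_fun A w ps h)"
    by simp
  moreover have "(w, s, minor_fun A w ps h) \<in> M"
    using assms w ps h by (auto simp: minor_closed_def)
  ultimately show "(w, s, minor_fun (sorted_power k A) w ps g) \<in> op_power A k ` M"
    by (rule image_eqI)
qed

text \<open>Finiteness makes the value table of an operation a tuple, so that a single relation pair
  can test whether the operation is a minor of a member of \<open>F\<close>.\<close>

lemma mPol_mInv_minor_closed:
  assumes fin: "\<forall>s\<in>S. finite (A s)" and F: "F \<subseteq> Op S A" and closed: "minor_closed S A F"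
  shows "mPol S A (mInv S A F) = F"
proof
  show "F \<subseteq> mPol S A (mInv S A F)"
    using F by (auto simp: mPol_def mInv_def)
  show "mPol S A (mInv S A F) \<subseteq> F"
  proof
    fix f assume f: "f \<in> mPol S A (mInv S A F)"
    obtain w s g where f_eq: "f = (w, s, g)" by (cases f)
    from f have w: "w \<in> lists S" and s: "s \<in> S" and g: "g \<in> word_prod A w \<rightarrow>\<^sub>E A s"
      by (auto simp: f_eq mPol_def Op_def)
    obtain xs where xs: "set xs = word_prod A w"
      using finite_list[OF finite_word_prod[OF w fin]] by blast
    \<comment> \<open>The matrix has the argument tuples \<open>xs\<close> of \<open>g\<close> as its columns. Its \<open>i\<close>-th row has the
      sort of the \<open>i\<close>-th argument place, and \<open>g\<close> maps the list of all rows to its value table.\<close>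
    define N where "N = length xs"
    define row where "row i = map (\<lambda>x. x ! i) xs" for i
    define R where "R = (\<lambda>t\<in>S. {row i | i. i < length w \<and> w ! i = t})"
    define R' where "R' = (\<lambda>t\<in>S. {coordinatewise N h rs | v h rs.
      (v, t, h) \<in> F \<and> rs \<in> word_prod R v})"
    have R: "\<forall>t\<in>S. R t \<subseteq> nlists N (A t)"
    proof -
      have "x ! i \<in> A (w ! i)" if "x \<in> set xs" "i < length w" for x i
        using that xs by (simp add: word_prod_iff)
      then show ?thesis
        by (auto simp: R_def row_def nlists_def N_def)
    qed
    moreover have "R' t \<subseteq> nlists N (A t)" if "t \<in> S" for t
      using that F coordinatewise_in_nlists[OF _ _ R]
      by (auto simp: R'_def)
    ultimately have T: "(N, R, R') \<in> Relp S A"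
      by (auto simp: Relp_def Rel_def R_def R'_def PiE_iff)
    moreover have "preserves h (N, R, R')" if h: "h \<in> F" for h
      using h F by (cases h) (force simp: R'_def Op_def)
    ultimately have "(N, R, R') \<in> mInv S A F"
      unfolding mInv_def by blast
    then have "preserves (w, s, g) (N, R, R')"
      using f by (auto simp: f_eq mPol_def simp del: preserves.simps)
    moreover have rows: "map row [0..<length w] \<in> word_prod R w"
      using w by (auto simp: word_prod_iff R_def in_lists_conv_set)
    ultimately have "coordinatewise N g (map row [0..<length w]) \<in> R' s"
      by simp
    with s obtain v h rs where h: "(v, s, h) \<in> F" and rs: "rs \<in> word_prod R v"
      and table: "coordinatewise N g (map row [0..<length w]) = coordinatewise N h rs"
      by (auto simp: R'_def)
    \<comment> \<open>Each argument of \<open>h\<close> in this representation of the table is itself a row, so it reads off one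
      argument place of \<open>g\<close>; these places define the minor.\<close>
    have v: "v \<in> lists S" using F h by (auto simp: Op_def)
    have "\<exists>p<length w. w ! p = v ! i \<and> rs ! i = row p" if "i < length v" for i
      using that rs v by (auto simp: word_prod_iff R_def in_lists_conv_set)
    then obtain p where p: "\<And>i. i < length v \<Longrightarrow>
        p i < length w \<and> w ! p i = v ! i \<and> rs ! i = row (p i)"
      by metis
    define ps where "ps = map p [0..<length v]"
    have ps: "set ps \<subseteq> {..<length w}" and v_eq: "v = map ((!) w) ps"
      using p by (auto simp: ps_def intro!: nth_equalityI)
    have rs_eq: "rs = map row ps"
      using p rs by (auto simp: ps_def word_prod_iff intro!: nth_equalityI)
    have "g x = minor_fun A w ps h x" if x: "x \<in> word_prod A w" for x
    proof -
      obtain j where j: "j < N" and xj: "x = xs ! j"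
        using x unfolding xs[symmetric] N_def in_set_conv_nth by blast
      have "map (\<lambda>r. r ! j) (map row [0..<length w]) = x"
        using x j by (auto simp: row_def xj N_def word_prod_iff intro!: nth_equalityI)
      moreover have "map (\<lambda>r. r ! j) rs = map ((!) x) ps"
        using j by (simp add: rs_eq row_def xj N_def)
      moreover have "g (map (\<lambda>r. r ! j) (map row [0..<length w])) = h (map (\<lambda>r. r ! j) rs)"
        using arg_cong[OF table, of "\<lambda>l. l ! j"] j by (simp add: coordinatewise_def)
      ultimately show ?thesis
        using x by (simp add: minor_fun_def)
    qed
    then have "g = minor_fun A w ps h"
      using g by (intro extensionalityI[of _ "word_prod A w"])
        (auto simp: minor_fun_def PiE_def)
    with closed w ps h show "f \<in> F"
      by (auto simp: minor_closed_def f_eq v_eq)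
  qed
qed

section \<open>Polymorphisms of flattened relation pairs\<close>

lemma mPol_cong:
  assumes "sorted_eq S A B"
  shows "mPol S A = mPol S B"
proof -
  have "word_prod A w \<rightarrow>\<^sub>E A s = word_prod B w \<rightarrow>\<^sub>E B s" if "w \<in> lists S" "s \<in> S" for w s
    using assms that word_prod_cong[of w S A B] by (simp add: sorted_eq_def)
  then have "Op S A = Op S B"
    unfolding Op_def by blast
  then show ?thesis by (intro ext) (simp add: mPol_def)
qed

lemma Relp_cong:
  assumes "sorted_eq S A B"
  shows "Relp S A = Relp S B"
proof -
  have "Rel S A m = Rel S B m" for m
    unfolding Rel_def using assms by (intro PiE_cong) (simp add: sorted_eq_def)
  then show ?thesis by (simp add: Relp_def)
qed

lemma mInv_cong:
  assumes "sorted_eq S A B"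
  shows "mInv S A = mInv S B"
  by (intro ext) (simp add: mInv_def Relp_cong[OF assms])

lemma mPol_flat:
  assumes "k \<ge> 1" "Q \<subseteq> Relp S (sorted_power k A)"
  shows "mPol S A (flat S k Q) = {f \<in> Op S A. op_power A k f \<in> mPol S (sorted_power k A) Q}"
proof -
  have "(\<forall>q\<in>flat S k Q. preserves f q) \<longleftrightarrow> (\<forall>T\<in>Q. preserves (op_power A k f) T)"
    if "f \<in> Op S A" for f
    using preserves_op_power_iff[OF assms(1) that subsetD[OF assms(2)]]
    by (simp add: flat_eq_image)
  then show ?thesis
    by (simp add: mPol_def op_power_in_Op cong: conj_cong)
qed

section \<open>Powers of polymorphism sets\<close>

theorem proposition4p7:
  fixes S :: "'s set"
    and A :: "'s \<Rightarrow> 'a set"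
    and B :: "'s \<Rightarrow> 'a list set"
    and QA :: "('s, 'a) rel_pair set"
    and QB :: "('s, 'a list) rel_pair set"
    and M1 :: "('s, 'a) sorted_op set"
    and M2 :: "('s, 'a list) sorted_op set"
  assumes "\<forall>s\<in>S. finite (A s)"
    and "\<forall>s\<in>S. finite (B s)"
    and "QA \<subseteq> Relp S A"
    and "QB \<subseteq> Relp S B"
    and "M1 = mPol S A QA"
    and "M2 = mPol S B QB"
  shows
    "((\<exists>k\<ge>1. sorted_eq S B (sorted_power k A) \<and> M2 = op_power A k ` M1) \<longleftrightarrow>
      (\<exists>k\<ge>1. sorted_eq S B (sorted_power k A) \<and>
         sharp S k (minor_closure S A QA) = minor_closure S B QB)) \<and>
     ((\<exists>k\<ge>1. sorted_eq S B (sorted_power k A) \<and> M2 = op_power A k ` M1) \<longrightarrow>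
      (\<exists>k\<ge>1. sorted_eq S B (sorted_power k A) \<and>
         minor_closure S A (flat S k QB) = minor_closure S A QA))"
proof -
  have M1: "M1 \<subseteq> Op S A" and closed1: "minor_closed S A M1"
    using minor_closed_mPol[OF assms(3)] by (auto simp: assms(5) mPol_def)
  have M2: "M2 \<subseteq> Op S B" and closed2: "minor_closed S B M2"
    using minor_closed_mPol[OF assms(4)] by (auto simp: assms(6) mPol_def)
  have power_iff: "M2 = op_power A k ` M1 \<longleftrightarrow>
      sharp S k (minor_closure S A QA) = minor_closure S B QB"
    and flat: "M2 = op_power A k ` M1 \<Longrightarrow>
      minor_closure S A (flat S k QB) = minor_closure S A QA"
    if k: "k \<ge> 1" and B: "sorted_eq S B (sorted_power k A)" for k
  proof -
    let ?P = "op_power A k ` M1"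
    have sharp: "sharp S k (minor_closure S A QA) = mInv S B ?P"
      using sharp_mInv[OF k M1] by (simp add: minor_closure_def assms(5) mInv_cong[OF B])
    have "\<forall>s\<in>S. finite (sorted_power k A s)"
      using assms(2) B by (simp add: sorted_eq_def)
    then have "mPol S B (mInv S B ?P) = ?P"
      unfolding mPol_cong[OF B] mInv_cong[OF B]
      using M1 op_power_in_Op
      by (intro mPol_mInv_minor_closed minor_closed_op_power[OF closed1]) blast+
    moreover have "mPol S B (mInv S B M2) = M2"
      by (rule mPol_mInv_minor_closed[OF assms(2) M2 closed2])
    ultimately have "M2 = ?P \<longleftrightarrow> mInv S B ?P = mInv S B M2"
      by metis
    then show "M2 = ?P \<longleftrightarrow> sharp S k (minor_closure S A QA) = minor_closure S B QB"
      unfolding sharp by (simp add: minor_closure_def assms(6))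
    assume P: "M2 = ?P"
    have "mPol S A (flat S k QB) = {f \<in> Op S A. op_power A k f \<in> ?P}"
      using mPol_flat[OF k, of QB S A] assms(4) P
      by (simp add: Relp_cong[OF B] mPol_cong[OF B] assms(6))
    also have "\<dots> = M1"
      using inj_on_image_mem_iff[OF inj_on_op_power[OF k] _ M1] M1 by blast
    finally show "minor_closure S A (flat S k QB) = minor_closure S A QA"
      by (simp add: minor_closure_def assms(5))
  qed
  show ?thesis
  proof (rule conjI)
    show "(\<exists>k\<ge>1. sorted_eq S B (sorted_power k A) \<and> M2 = op_power A k ` M1) \<longleftrightarrow>
      (\<exists>k\<ge>1. sorted_eq S B (sorted_power k A) \<and>
         sharp S k (minor_closure S A QA) = minor_closure S B QB)"
      by (simp only: power_iff cong: conj_cong)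
    show "(\<exists>k\<ge>1. sorted_eq S B (sorted_power k A) \<and> M2 = op_power A k ` M1) \<longrightarrow>
      (\<exists>k\<ge>1. sorted_eq S B (sorted_power k A) \<and>
         minor_closure S A (flat S k QB) = minor_closure S A QA)"
      by (intro impI, elim exE conjE, intro exI conjI flat)
  qed
qed

end
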